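(* Let $G=(V,E)$ be a finite, connected, undirected graph and let $\pi$ be a probability distribution on $V$ with $\pi(x)>0$ for all $x\in V$. There exists a time-inhomogeneous Markov chain on $G$ that perfectly mixes to $\pi$ after $2\operatorname{diam} G$ steps; that is, there is a sequence $(P_t)_{t\ge1}$ of transition matrices on $G$ such that, for every initial law $\mu_0$ on $V$, the law $\mu_t := \mu_0P_1P_2\cdots P_t$ satisfies $\mu_{2\operatorname{diam} G} = \pi$.
   Context: A transition matrix $P\in[0,1]^{V\times V}$ (rows summing to 1) is on $G=(V,E)$ if $P(u,v)>0$ implies $\{u,v\}\in E$ or $u=v$. A time-inhomogeneous Markov chain is described by a sequence $(P_t)_{t\ge 1}$ of transition matrices and an initial law $\mu_0$; its time-$t$ law is $\mu_t=\mu_0P_1\cdots P_t$. $\operatorname{diam} G$ is the graph diameter. *)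

theory Defs
  imports "Graph_Theory.Graph_Theory"
begin

text \<open>
  An undirected graph is a symmetric digraph (locale \<open>graph\<close>: finite, simple and symmetric), so
  \<open>u \<rightarrow>\<^bsub>G\<^esub> v\<close> says that \<open>{u, v}\<close> is an edge. \<open>connected\<close> entails a nonempty vertex set.
\<close>

text \<open>
  For unreachable pairs the infimum in \<open>nat\<close> is over the empty set and is \<open>0\<close>, so this is the usual
  distance only if \<open>v\<close> is reachable from \<open>u\<close>.
\<close>

definition graph_dist :: "('a, 'b) pre_digraph \<Rightarrow> 'a \<Rightarrow> 'a \<Rightarrow> nat" where
  "graph_dist G u v = (INF p\<in>{p. pre_digraph.awalk G u p v}. length p)"

text \<open>Meaningful for finite connected graphs only.\<close>

definition graph_diam :: "('a, 'b) pre_digraph \<Rightarrow> nat" where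
  "graph_diam G = Max {graph_dist G u v | u v. u \<in> verts G \<and> v \<in> verts G}"

lemma (in wf_digraph) shortest_path_eq_graph_dist:
  assumes "u \<rightarrow>\<^sup>*\<^bsub>G\<^esub> v"
  shows "\<mu> (\<lambda>_. 1) u v = ereal (real (graph_dist G u v))"
proof -
  have cost: "awalk_cost (\<lambda>_. 1) p = real (length p)" for p
    by (induction p) simp_all
  have ne: "length ` {p. awalk u p v} \<noteq> {}"
    using assms by (auto simp: reachable_awalk)
  obtain q where q: "awalk u q v" "length q = graph_dist G u v"
    using Inf_nat_def1[OF ne] unfolding graph_dist_def by auto
  show ?thesis
    unfolding \<mu>_def cost
  proof (rule INF_eqI)
    fix p assume "p \<in> {p. awalk u p v}"
    then show "ereal (real (graph_dist G u v)) \<le> ereal (real (length p))"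
      unfolding graph_dist_def by (auto intro!: cINF_lower)
  next
    fix y assume "\<And>p. p \<in> {p. awalk u p v} \<Longrightarrow> y \<le> ereal (real (length p))"
    from this[of q] show "y \<le> ereal (real (graph_dist G u v))"
      using q by simp
  qed
qed

text \<open>
  Vectors and matrices indexed by \<open>V\<close> are functions on the ambient type of which only the values
  at elements of \<open>V\<close> matter.
\<close>

definition distribution_on :: "'a set \<Rightarrow> ('a \<Rightarrow> real) \<Rightarrow> bool" where
  "distribution_on V \<mu> \<longleftrightarrow> (\<forall>x\<in>V. 0 \<le> \<mu> x) \<and> (\<Sum>x\<in>V. \<mu> x) = 1"

definition transition_matrix :: "'a set \<Rightarrow> ('a \<Rightarrow> 'a \<Rightarrow> real) \<Rightarrow> bool" where
  "transition_matrix V P \<longleftrightarrow>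
     (\<forall>u\<in>V. \<forall>v\<in>V. 0 \<le> P u v \<and> P u v \<le> 1) \<and> (\<forall>u\<in>V. (\<Sum>v\<in>V. P u v) = 1)"

definition transition_matrix_on_graph ::
    "('a, 'b) pre_digraph \<Rightarrow> ('a \<Rightarrow> 'a \<Rightarrow> real) \<Rightarrow> bool" where
  "transition_matrix_on_graph G P \<longleftrightarrow>
     transition_matrix (verts G) P \<and>
     (\<forall>u\<in>verts G. \<forall>v\<in>verts G. P u v > 0 \<longrightarrow> u \<rightarrow>\<^bsub>G\<^esub> v \<or> u = v)"

text \<open>The chain starts with \<open>P 1\<close>; the entry \<open>P 0\<close> is never used.\<close>

primrec chain_law ::
    "'a set \<Rightarrow> ('a \<Rightarrow> real) \<Rightarrow> (nat \<Rightarrow> 'a \<Rightarrow> 'a \<Rightarrow> real) \<Rightarrow> nat \<Rightarrow> 'a \<Rightarrow> real" where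
  "chain_law V \<mu>0 P 0 = \<mu>0"
| "chain_law V \<mu>0 P (Suc t) = (\<lambda>y. \<Sum>x\<in>V. chain_law V \<mu>0 P t x * P (Suc t) x y)"

end

theory Submission
  imports Defs
begin

text \<open>
  Fix a root \<open>r\<close> and a map \<open>f\<close> that sends every other vertex one edge closer to \<open>r\<close>. With
  \<open>D = graph_diam G\<close>, the iterate \<open>f ^^ D\<close> is constantly \<open>r\<close>, so following \<open>f\<close> deterministically
  for \<open>D\<close> steps turns every law, in particular both \<open>\<mu>0\<close> and \<open>\<pi>\<close>, into the point mass at \<open>r\<close>
  (\<open>pushforward_collapse\<close>). The first half of the chain does this to \<open>\<mu>0\<close>. The second half replays
  the collapse of \<open>\<pi>\<close> backwards: if \<open>\<nu>\<close> is the law before a move along \<open>f\<close>, the conditional law of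
  the starting vertex given the vertex reached is a transition matrix that leads from the law after
  the move back to \<open>\<nu>\<close> (\<open>pushforward_lift\<close>). It uses the edges of \<open>f\<close> in the opposite direction,
  which is allowed because the graph is undirected.
\<close>

section \<open>Moving along a map and back\<close>

definition pushforward :: "'a set \<Rightarrow> ('a \<Rightarrow> 'a) \<Rightarrow> ('a \<Rightarrow> real) \<Rightarrow> 'a \<Rightarrow> real" where
  "pushforward V f \<mu> y = (\<Sum>x\<in>V. \<mu> x * of_bool (f x = y))"

text \<open>
  The conditional law of the vertex before a move along \<open>f\<close>, given that the move led to \<open>u\<close>, when
  the law before the move is \<open>\<nu>\<close>. Vertices that are reached with probability \<open>0\<close> stay where they
  are, so that the rows still sum to \<open>1\<close>.
\<close>

definition lift :: "'a set \<Rightarrow> ('a \<Rightarrow> 'a) \<Rightarrow> ('a \<Rightarrow> real) \<Rightarrow> 'a \<Rightarrow> 'a \<Rightarrow> real" where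
  "lift V f \<nu> u v =
     (if pushforward V f \<nu> u = 0 then of_bool (u = v)
      else \<nu> v * of_bool (f v = u) / pushforward V f \<nu> u)"

lemma pushforward_nonneg: "\<forall>x\<in>V. 0 \<le> \<mu> x \<Longrightarrow> 0 \<le> pushforward V f \<mu> y"
  unfolding pushforward_def by (intro sum_nonneg) auto

lemma pushforward_cong:
  "\<forall>x\<in>V. \<mu> x = \<nu> x \<Longrightarrow> pushforward V f \<mu> y = pushforward V f \<nu> y"
  unfolding pushforward_def by (intro sum.cong) auto

lemma pushforward_funpow_0:
  assumes "finite V" "y \<in> V"
  shows "pushforward V (f ^^ 0) \<mu> y = \<mu> y"
  using assms by (simp add: pushforward_def of_bool_def if_distrib cong: if_cong)

lemma pushforward_comp:
  assumes "finite V" and "g ` V \<subseteq> V"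
  shows "pushforward V f (pushforward V g \<mu>) y = pushforward V (f \<circ> g) \<mu> y"
proof -
  have "pushforward V f (pushforward V g \<mu>) y =
        (\<Sum>z\<in>V. \<Sum>x\<in>V. \<mu> z * of_bool (g z = x) * of_bool (f x = y))"
    unfolding pushforward_def sum_distrib_right by (rule sum.swap)
  also have "\<dots> = (\<Sum>z\<in>V. \<mu> z * of_bool (f (g z) = y))"
  proof (rule sum.cong)
    fix z assume "z \<in> V"
    then have "g z \<in> V" using assms by auto
    have "(\<Sum>x\<in>V. \<mu> z * of_bool (g z = x) * of_bool (f x = y)) =
          (\<Sum>x\<in>V. if g z = x then \<mu> z * of_bool (f x = y) else 0)"
      by (intro sum.cong) auto
    then show "(\<Sum>x\<in>V. \<mu> z * of_bool (g z = x) * of_bool (f x = y)) =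
        \<mu> z * of_bool (f (g z) = y)"
      using \<open>g z \<in> V\<close> assms(1) by simp
  qed simp
  finally show ?thesis by (simp add: pushforward_def)
qed

lemma funpow_image_subset: "f ` V \<subseteq> V \<Longrightarrow> (f ^^ n) ` V \<subseteq> V"
  by (induction n) auto

lemma pushforward_funpow_Suc:
  assumes "finite V" and "f ` V \<subseteq> V"
  shows "pushforward V f (pushforward V (f ^^ n) \<mu>) y = pushforward V (f ^^ Suc n) \<mu> y"
  using pushforward_comp[OF assms(1) funpow_image_subset[OF assms(2)]] by simp

lemma pushforward_collapse:
  assumes "distribution_on V \<mu>" and "\<forall>x\<in>V. f x = r"
  shows "pushforward V f \<mu> y = of_bool (y = r)"
proof -
  have "pushforward V f \<mu> y = (\<Sum>x\<in>V. \<mu> x * of_bool (y = r))"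
    unfolding pushforward_def using assms(2) by (intro sum.cong) auto
  then show ?thesis
    using assms(1) by (simp add: distribution_on_def flip: sum_distrib_right)
qed

text \<open>
  The law of total probability for the vertex before the move, conditioned on the vertex after it.
  The arbitrary rows of \<open>lift\<close> at vertices reached with probability \<open>0\<close> do no harm: they get weight
  \<open>0\<close>, and \<open>\<nu>\<close> vanishes at all vertices that \<open>f\<close> sends there.
\<close>

lemma pushforward_lift:
  assumes "finite V" and "f ` V \<subseteq> V" and nonneg: "\<forall>x\<in>V. 0 \<le> \<nu> x" and v: "v \<in> V"
  shows "(\<Sum>u\<in>V. pushforward V f \<nu> u * lift V f \<nu> u v) = \<nu> v"
proof -
  have fv: "f v \<in> V" using assms by auto
  have null: "\<nu> v = 0" if "pushforward V f \<nu> (f v) = 0"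
  proof -
    have "\<forall>x\<in>V. \<nu> x * of_bool (f x = f v) = 0"
      using that nonneg assms(1) unfolding pushforward_def by (subst (asm) sum_nonneg_eq_0_iff) auto
    then show ?thesis using v by auto
  qed
  have "(\<Sum>u\<in>V. pushforward V f \<nu> u * lift V f \<nu> u v) = (\<Sum>u\<in>V. if f v = u then \<nu> v else 0)"
    using null by (intro sum.cong) (auto simp: lift_def)
  then show ?thesis using fv assms(1) by simp
qed

lemma transition_matrixI:
  assumes "finite V" and "\<And>u v. u \<in> V \<Longrightarrow> v \<in> V \<Longrightarrow> 0 \<le> P u v"
    and "\<And>u. u \<in> V \<Longrightarrow> (\<Sum>v\<in>V. P u v) = 1"
  shows "transition_matrix V P"
  unfolding transition_matrix_def
proof (intro conjI ballI)
  fix u v assume "u \<in> V" "v \<in> V"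
  then show "P u v \<le> 1" using assms member_le_sum[of v V "P u"] by simp
qed (use assms in auto)

lemma transition_matrix_map:
  assumes "finite V" and "f ` V \<subseteq> V"
  shows "transition_matrix V (\<lambda>u v. of_bool (f u = v))"
  using assms by (intro transition_matrixI) (auto simp: of_bool_def)

lemma transition_matrix_lift:
  assumes "finite V" and "\<forall>x\<in>V. 0 \<le> \<nu> x"
  shows "transition_matrix V (lift V f \<nu>)"
proof (rule transition_matrixI)
  fix u v assume "u \<in> V" "v \<in> V"
  then show "0 \<le> lift V f \<nu> u v"
    using assms pushforward_nonneg[OF assms(2)] by (simp add: lift_def)
next
  fix u assume u: "u \<in> V"
  show "(\<Sum>v\<in>V. lift V f \<nu> u v) = 1"
  proof (cases "pushforward V f \<nu> u = 0")
    case True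
    then show ?thesis using u assms(1) by (simp add: lift_def of_bool_def)
  next
    case False
    then show ?thesis
      by (simp add: lift_def flip: sum_divide_distrib pushforward_def)
  qed
qed (fact assms)

section \<open>Descending to a root\<close>

context wf_digraph
begin

lemma graph_dist_le_length: "awalk u p v \<Longrightarrow> graph_dist G u v \<le> length p"
  unfolding graph_dist_def by (auto intro: cINF_lower)

lemma shortest_awalk_exists:
  assumes "u \<rightarrow>\<^sup>*\<^bsub>G\<^esub> v"
  obtains p where "awalk u p v" and "length p = graph_dist G u v"
proof -
  have ne: "length ` {p. awalk u p v} \<noteq> {}"
    using assms by (auto simp: reachable_awalk)
  show ?thesis
    using Inf_nat_def1[OF ne] that unfolding graph_dist_def by auto
qed

text \<open>The second vertex of a shortest walk to \<open>r\<close> is nearer to \<open>r\<close>.\<close>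

lemma nearer_out_neighbour_exists:
  assumes "v \<rightarrow>\<^sup>*\<^bsub>G\<^esub> r" and "v \<noteq> r"
  obtains w where "v \<rightarrow>\<^bsub>G\<^esub> w" and "graph_dist G w r < graph_dist G v r"
proof -
  obtain p where p: "awalk v p r" "length p = graph_dist G v r"
    using shortest_awalk_exists[OF assms(1)] .
  with assms(2) obtain e q where [simp]: "p = e # q"
    by (cases p) (auto simp: awalk_Nil_iff)
  then have e: "e \<in> arcs G" "v = tail G e" "awalk (head G e) q r"
    using p(1) by (auto simp: awalk_Cons_iff)
  show ?thesis
  proof
    show "v \<rightarrow>\<^bsub>G\<^esub> head G e" using e by (auto simp: arcs_ends_def arc_to_ends_def)
    show "graph_dist G (head G e) r < graph_dist G v r"
      using graph_dist_le_length[OF e(3)] p(2) by simp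
  qed
qed

end

lemma (in fin_digraph) graph_dist_le_diam:
  assumes "u \<in> verts G" and "v \<in> verts G"
  shows "graph_dist G u v \<le> graph_diam G"
proof -
  have "{graph_dist G u v | u v. u \<in> verts G \<and> v \<in> verts G} =
        (\<lambda>(u, v). graph_dist G u v) ` (verts G \<times> verts G)"
    by auto
  then show ?thesis
    using assms unfolding graph_diam_def by (intro Max_ge) auto
qed

text \<open>Induction on \<open>n\<close>: a move along \<open>f\<close> lowers the height \<open>d\<close> until \<open>r\<close> is reached.\<close>

lemma funpow_descent:
  fixes d :: "'a \<Rightarrow> nat"
  assumes "f ` V \<subseteq> V" and "f r = r" and "\<And>v. v \<in> V \<Longrightarrow> v \<noteq> r \<Longrightarrow> d (f v) < d v"
    and "v \<in> V" and "d v \<le> n"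
  shows "(f ^^ n) v = r"
  using assms(4,5)
proof (induction n arbitrary: v)
  case 0
  then show ?case using assms(3)[of v] by auto
next
  case (Suc n)
  have "d (f v) \<le> n" if "v \<noteq> r"
    using assms(3)[OF Suc.prems(1) that] Suc.prems(2) by simp
  moreover have "(f ^^ k) r = r" for k
    by (induction k) (use assms(2) in auto)
  moreover have "f v \<in> V" using Suc.prems(1) assms(1) by auto
  ultimately show ?case
    using Suc.IH assms(2) by (cases "v = r") (auto simp: funpow_Suc_right simp del: funpow.simps)
qed

lemma (in fin_digraph) collapsing_map_exists:
  assumes "strongly_connected G"
  obtains f r where "f ` verts G \<subseteq> verts G" and "\<And>v. v \<in> verts G \<Longrightarrow> v \<rightarrow>\<^bsub>G\<^esub> f v \<or> f v = v"
    and "\<And>v. v \<in> verts G \<Longrightarrow> (f ^^ graph_diam G) v = r"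
proof -
  obtain r where r: "r \<in> verts G"
    using assms by (auto simp: strongly_connected_def)
  have "\<exists>w. v \<rightarrow>\<^bsub>G\<^esub> w \<and> graph_dist G w r < graph_dist G v r" if "v \<in> verts G" "v \<noteq> r" for v
    using nearer_out_neighbour_exists[of v r] assms r that by (auto simp: strongly_connected_def)
  then obtain g where g: "\<And>v. v \<in> verts G \<Longrightarrow> v \<noteq> r \<Longrightarrow>
      v \<rightarrow>\<^bsub>G\<^esub> g v \<and> graph_dist G (g v) r < graph_dist G v r"
    by metis
  define f where "f v = (if v = r then r else g v)" for v
  have f: "f ` verts G \<subseteq> verts G"
    using g r by (auto simp: f_def dest: adj_in_verts)
  show ?thesis
  proof
    show "f ` verts G \<subseteq> verts G" by (fact f)
    show "v \<rightarrow>\<^bsub>G\<^esub> f v \<or> f v = v" if "v \<in> verts G" for v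
      using g that by (auto simp: f_def)
    show "(f ^^ graph_diam G) v = r" if "v \<in> verts G" for v
      using funpow_descent[where f = f and d = "\<lambda>v. graph_dist G v r", OF f _ _ that]
        g graph_dist_le_diam[OF that r] by (simp add: f_def)
  qed
qed

section \<open>The collapsing and lifting chain\<close>

lemma chain_law_along_map:
  assumes "finite V" and "f ` V \<subseteq> V" and "\<And>t. t \<in> {1..n} \<Longrightarrow> P t = (\<lambda>u v. of_bool (f u = v))"
    and "y \<in> V"
  shows "chain_law V \<mu> P n y = pushforward V (f ^^ n) \<mu> y"
  using assms(3,4)
proof (induction n arbitrary: y)
  case 0
  then show ?case by (simp only: chain_law.simps pushforward_funpow_0[OF assms(1)])
next
  case (Suc n)
  have "chain_law V \<mu> P (Suc n) y = pushforward V f (chain_law V \<mu> P n) y"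
    using Suc.prems(1)[of "Suc n"] by (simp add: pushforward_def)
  also have "\<dots> = pushforward V f (pushforward V (f ^^ n) \<mu>) y"
    using Suc by (intro pushforward_cong) auto
  also have "\<dots> = pushforward V (f ^^ Suc n) \<mu> y"
    by (rule pushforward_funpow_Suc[OF assms(1,2)])
  finally show ?case .
qed

text \<open>
  The chains started at \<open>\<mu>\<close> and \<open>\<pi>\<close> both sit at \<open>r\<close> at time \<open>D\<close>, so from then on the collapse of \<open>\<pi>\<close>
  can be undone one step at a time, whatever \<open>\<mu>\<close> was.
\<close>

lemma chain_law_collapse_lift:
  assumes "finite V" and f: "f ` V \<subseteq> V" and collapse: "\<And>v. v \<in> V \<Longrightarrow> (f ^^ D) v = r"
    and \<mu>: "distribution_on V \<mu>" and \<pi>: "distribution_on V \<pi>"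
    and down: "\<And>t. t \<in> {1..D} \<Longrightarrow> P t = (\<lambda>u v. of_bool (f u = v))"
    and up: "\<And>s. s \<in> {1..D} \<Longrightarrow> P (D + s) = lift V f (pushforward V (f ^^ (D - s)) \<pi>)"
    and "s \<le> D" and "y \<in> V"
  shows "chain_law V \<mu> P (D + s) y = pushforward V (f ^^ (D - s)) \<pi> y"
  using assms(8,9)
proof (induction s arbitrary: y)
  case 0
  have "chain_law V \<mu> P D y = pushforward V (f ^^ D) \<mu> y"
    using chain_law_along_map[OF assms(1) f down 0(2)] by simp
  also have "\<dots> = pushforward V (f ^^ D) \<pi> y"
    using collapse pushforward_collapse[OF \<mu>] pushforward_collapse[OF \<pi>] by metis
  finally show ?case by simp
next
  case (Suc s)
  let ?\<nu> = "pushforward V (f ^^ (D - Suc s)) \<pi>"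
  have "D - s = Suc (D - Suc s)" using Suc.prems by simp
  then have "chain_law V \<mu> P (D + s) x = pushforward V f ?\<nu> x" if "x \<in> V" for x
    using Suc that pushforward_funpow_Suc[OF assms(1) f] by (simp del: funpow.simps)
  then have "chain_law V \<mu> P (D + Suc s) y =
      (\<Sum>x\<in>V. pushforward V f ?\<nu> x * lift V f ?\<nu> x y)"
    using up[of "Suc s"] Suc.prems(1) by simp
  also have "\<dots> = ?\<nu> y"
    using \<pi> by (intro pushforward_lift[OF assms(1) f _ Suc.prems(2)] ballI pushforward_nonneg)
      (simp add: distribution_on_def)
  finally show ?case .
qed

theorem theorem4:
  fixes G :: "('a, 'b) pre_digraph" and \<pi> :: "'a \<Rightarrow> real"
  assumes "graph G" and "connected G"
    and "distribution_on (verts G) \<pi>" and "\<forall>x\<in>verts G. \<pi> x > 0"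
  shows "\<exists>P :: nat \<Rightarrow> 'a \<Rightarrow> 'a \<Rightarrow> real.
           (\<forall>t\<ge>1. transition_matrix_on_graph G (P t)) \<and>
           (\<forall>\<mu>0. distribution_on (verts G) \<mu>0 \<longrightarrow>
              (\<forall>x\<in>verts G. chain_law (verts G) \<mu>0 P (2 * graph_diam G) x = \<pi> x))"
proof -
  interpret graph G by fact
  let ?V = "verts G" and ?D = "graph_diam G"
  have sc: "strongly_connected G"
    using assms(2) by (simp add: connected_def strongly_connected_def reachable_mk_symmetric_eq[OF sym_arcs])
  obtain f r where f: "f ` ?V \<subseteq> ?V" and step: "\<And>v. v \<in> ?V \<Longrightarrow> v \<rightarrow>\<^bsub>G\<^esub> f v \<or> f v = v"
    and collapse: "\<And>v. v \<in> ?V \<Longrightarrow> (f ^^ ?D) v = r"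
    using collapsing_map_exists[OF sc] by metis
  \<comment> \<open>For \<open>t > 2 * ?D\<close> the truncated difference is \<open>0\<close>, which still gives a transition matrix.\<close>
  define P where "P t = (if t \<le> ?D then (\<lambda>u v. of_bool (f u = v))
      else lift ?V f (pushforward ?V (f ^^ (2 * ?D - t)) \<pi>))" for t
  have "transition_matrix_on_graph G (\<lambda>u v. of_bool (f u = v))"
    unfolding transition_matrix_on_graph_def
    using transition_matrix_map[OF finite_verts f] step by simp metis
  moreover have "transition_matrix_on_graph G (lift ?V f (pushforward ?V g \<pi>))" for g
    unfolding transition_matrix_on_graph_def
  proof (intro conjI ballI impI)
    show "transition_matrix ?V (lift ?V f (pushforward ?V g \<pi>))"
      using assms(3) by (intro transition_matrix_lift ballI pushforward_nonneg)
        (auto simp: distribution_on_def)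
  next
    fix u v assume "v \<in> ?V" and pos: "0 < lift ?V f (pushforward ?V g \<pi>) u v"
    then have "u = v \<or> f v = u" by (auto simp: lift_def of_bool_def split: if_splits)
    then show "u \<rightarrow>\<^bsub>G\<^esub> v \<or> u = v"
      using step[OF \<open>v \<in> ?V\<close>] by (auto dest: arcs_ends_symmetric[OF sym_arcs])
  qed
  ultimately have "\<forall>t\<ge>1. transition_matrix_on_graph G (P t)"
    by (simp add: P_def)
  moreover have "chain_law ?V \<mu>0 P (2 * ?D) x = \<pi> x"
    if "distribution_on ?V \<mu>0" "x \<in> ?V" for \<mu>0 x
  proof -
    have "chain_law ?V \<mu>0 P (?D + ?D) x = pushforward ?V (f ^^ (?D - ?D)) \<pi> x"
      by (rule chain_law_collapse_lift[OF finite_verts f collapse that(1) assms(3)])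
        (use that(2) in \<open>auto simp: P_def\<close>)
    then show ?thesis
      using pushforward_funpow_0[OF finite_verts that(2)] by (simp add: mult_2)
  qed
  ultimately show ?thesis by blast
qed

end
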